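(* Let $t\ge2$ be an integer. If there is a projective plane of order $t$ or a projective plane of order $t-1$, then there is a constant $C_t$ such that $f_2(t,n)\leq n+C_t$ for all integers $n\ge 1$.
   Context: Graphs are finite and simple with nonempty vertex set. A clique of a graph is a set of pairwise adjacent vertices (sets with at most one vertex are cliques); a clique is maximal if it is maximal with respect to inclusion, and $c(G)$ is the number of maximal cliques of $G$. For integers $t\geq2$ and $n\geq1$, $f_2(t,n)$ is the minimum of $\sum_{i=1}^t c(G_i)$ over all factorizations of the complete graph $K_n$ into $t$ edge-disjoint spanning subgraphs $G_1,\dots,G_t$ (all on the same $n$ vertices, some possibly edgeless, whose edge sets partition the edge set of $K_n$). A projective plane of order $q$ ($q\ge2$) is the usual finite (nondegenerate) projective plane in which every line has $q+1$ points. *)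

theory Defs
  imports Main "HOL-Library.Disjoint_Sets"
begin

record 'a ugraph =
  verts :: "'a set"
  edges :: "'a set set"

definition simple_graph :: "'a ugraph \<Rightarrow> bool" where
  "simple_graph G \<longleftrightarrow>
     finite (verts G) \<and> verts G \<noteq> {} \<and> (\<forall>e\<in>edges G. e \<subseteq> verts G \<and> card e = 2)"

definition complete_graph :: "nat \<Rightarrow> nat ugraph" where
  "complete_graph n = \<lparr>verts = {..<n}, edges = {e. e \<subseteq> {..<n} \<and> card e = 2}\<rparr>"

definition clique :: "'a ugraph \<Rightarrow> 'a set \<Rightarrow> bool" where
  "clique G S \<longleftrightarrow> S \<subseteq> verts G \<and> (\<forall>u\<in>S. \<forall>v\<in>S. u \<noteq> v \<longrightarrow> {u, v} \<in> edges G)"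

definition maximal_clique :: "'a ugraph \<Rightarrow> 'a set \<Rightarrow> bool" where
  "maximal_clique G S \<longleftrightarrow> clique G S \<and> (\<forall>T. clique G T \<and> S \<subseteq> T \<longrightarrow> T = S)"

definition num_maximal_cliques :: "'a ugraph \<Rightarrow> nat" where
  "num_maximal_cliques G = card {S. maximal_clique G S}"

text \<open>The factors may be edgeless, so the edge sets form a disjoint indexed family
  rather than a set partition with nonempty blocks.\<close>

definition factorization :: "'a ugraph \<Rightarrow> nat \<Rightarrow> (nat \<Rightarrow> 'a ugraph) \<Rightarrow> bool" where
  "factorization K t G \<longleftrightarrow>
     (\<forall>i\<in>{1..t}. simple_graph (G i) \<and> verts (G i) = verts K) \<and>
     disjoint_family_on (\<lambda>i. edges (G i)) {1..t} \<and>
     (\<Union>i\<in>{1..t}. edges (G i)) = edges K"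

definition f2 :: "nat \<Rightarrow> nat \<Rightarrow> nat" where
  "f2 t n = (LEAST s. \<exists>G. factorization (complete_graph n) t G \<and>
                          s = (\<Sum>i\<in>{1..t}. num_maximal_cliques (G i)))"

text \<open>For \<open>t \<ge> 1\<close> and \<open>n \<ge> 1\<close> a factorization exists, so the minimum is attained.\<close>

lemma factorization_exists:
  assumes "t \<ge> 1" "n \<ge> 1"
  shows "\<exists>G. factorization (complete_graph n) t G"
proof
  let ?G = "\<lambda>i::nat. if i = 1 then complete_graph n else \<lparr>verts = {..<n}, edges = {}\<rparr>"
  show "factorization (complete_graph n) t ?G"
    using assms
    by (auto simp: factorization_def simple_graph_def complete_graph_def disjoint_family_on_def
        lessThan_empty_iff split: if_splits)
qed

lemma f2_attained:
  assumes "t \<ge> 1" "n \<ge> 1"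
  shows "\<exists>G. factorization (complete_graph n) t G \<and>
             f2 t n = (\<Sum>i\<in>{1..t}. num_maximal_cliques (G i))"
  unfolding f2_def by (rule LeastI_ex) (use factorization_exists[OF assms] in blast)

lemma f2_le:
  assumes "factorization (complete_graph n) t G"
  shows "f2 t n \<le> (\<Sum>i\<in>{1..t}. num_maximal_cliques (G i))"
  unfolding f2_def by (rule Least_le) (use assms in blast)

text \<open>Lines are identified with the sets of points incident with them.  Nondegeneracy is the
  existence of four points, no three of them on a common line.\<close>

definition projective_plane :: "nat \<Rightarrow> 'p set \<Rightarrow> 'p set set \<Rightarrow> bool" where
  "projective_plane q P L \<longleftrightarrow>
     q \<ge> 2 \<and> finite P \<and> (\<forall>l\<in>L. l \<subseteq> P) \<and>
     (\<forall>x\<in>P. \<forall>y\<in>P. x \<noteq> y \<longrightarrow> (\<exists>!l. l \<in> L \<and> x \<in> l \<and> y \<in> l)) \<and>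
     (\<forall>l\<in>L. \<forall>m\<in>L. l \<noteq> m \<longrightarrow> (\<exists>!x. x \<in> l \<and> x \<in> m)) \<and>
     (\<exists>Q\<subseteq>P. card Q = 4 \<and> (\<forall>l\<in>L. card (Q \<inter> l) \<le> 2)) \<and>
     (\<forall>l\<in>L. card l = q + 1)"

end

theory Submission
  imports Defs
begin

text \<open>
  The plan is to find a finite set \<open>V\<close>, a colouring of its points, and a factorization of the
  complete graph on \<open>V\<close> into \<open>t\<close> colours that can be repeated indefinitely at an average cost of one
  maximal clique per vertex.  The vertices \<open>0, 1, 2, \<dots>\<close> are cut into consecutive copies of \<open>V\<close>.  An
  edge inside a copy is coloured as in \<open>V\<close>; an edge between two copies gets the colour of its earlier
  end.  In the graph of colour \<open>p\<close> the vertices of colour \<open>p\<close> then form one large clique, and each of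
  them is joined to everything in later copies.  So if, inside \<open>V\<close>, the points of colour other than \<open>p\<close>
  are partitioned by certain blocks that are cliques of colour \<open>p\<close>, a maximal clique of colour \<open>p\<close> is
  either the large clique, or a block of some copy together with all vertices of colour \<open>p\<close> from
  earlier copies.  When the total number of blocks over all colours is at most \<open>card V\<close>, each copy
  costs at most \<open>card V\<close> cliques, and the bound \<open>n + C\<close> follows (\<open>f2_le_linear\<close>).

  Projective planes supply such patterns (\<open>plane_pattern\<close>).  Fix a line \<open>L0\<close> and a point \<open>a\<close>, and let \<open>V\<close>
  be the set of points off \<open>L0\<close> other than \<open>a\<close>.  The colours are the points of \<open>L0\<close> other than \<open>a\<close>.
  The pair \<open>x, y\<close> of \<open>V\<close> lies on one line.  If that line avoids \<open>a\<close>, the pair gets as colour the point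
  where the line meets \<open>L0\<close>, and the line is a block; the lines through \<open>a\<close> instead yield the colour
  classes of the points, one class for each line.
  If \<open>a\<close> lies on \<open>L0\<close> there are \<open>q\<close> colours, where \<open>q\<close> is the order; if not, there are \<open>q + 1\<close>.  These
  are the two cases of the theorem.  In affine terms, with \<open>L0\<close> at infinity, the first pattern is an
  affine plane in which the members of one parallel class are distributed among the other \<open>q\<close> classes;
  the second is an affine plane without its origin, where in each of the \<open>q + 1\<close> parallel classes the
  line through the origin becomes the colour class.
\<close>

section \<open>Repeating a finite pattern along the natural numbers\<close>

text \<open>
  Here \<open>R\<close> is the set of colours, \<open>\<phi>\<close> colours the points, and \<open>F p\<close> consists of the blocks of colour \<open>p\<close>.
  A pair of points has colour \<open>p\<close> if both points have this colour or if they share a block of \<open>F p\<close>.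
  A block may also contain points of its own colour: \<open>unique_block\<close> asks for a partition only of
  the remaining points, because only these have to be separated for the cliques to be under control.
\<close>

locale pattern =
  fixes V :: "'v set" and R :: "'c set" and \<phi> :: "'v \<Rightarrow> 'c" and F :: "'c \<Rightarrow> 'v set set"
  assumes finite_V: "finite V" and V_nonempty: "V \<noteq> {}"
    and finite_F: "p \<in> R \<Longrightarrow> finite (F p)"
    and colour_in: "x \<in> V \<Longrightarrow> \<phi> x \<in> R"
    and unique_block: "p \<in> R \<Longrightarrow> x \<in> V \<Longrightarrow> \<phi> x \<noteq> p \<Longrightarrow> \<exists>!l. l \<in> F p \<and> x \<in> l"
    and unique_colour: "x \<in> V \<Longrightarrow> y \<in> V \<Longrightarrow> x \<noteq> y \<Longrightarrow>
      \<exists>!p. p \<in> R \<and> (\<phi> x = p \<and> \<phi> y = p \<or> (\<exists>l\<in>F p. x \<in> l \<and> y \<in> l))"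
    and few_blocks: "(\<Sum>p\<in>R. card (F p)) \<le> card V"
begin

definition point :: "(nat \<Rightarrow> 'v) \<Rightarrow> nat \<Rightarrow> 'v" where
  "point e v = e (v mod card V)"

definition copy :: "nat \<Rightarrow> nat" where
  "copy v = v div card V"

text \<open>
  The relation is meant for \<open>u < v\<close>, so that \<open>u\<close> is the end whose colour decides between copies.
\<close>

definition joined :: "(nat \<Rightarrow> 'v) \<Rightarrow> 'c \<Rightarrow> nat \<Rightarrow> nat \<Rightarrow> bool" where
  "joined e p u v \<longleftrightarrow>
     (if copy u = copy v
      then \<phi> (point e u) = p \<and> \<phi> (point e v) = p \<or> (\<exists>l\<in>F p. point e u \<in> l \<and> point e v \<in> l)
      else \<phi> (point e u) = p)"

definition layer :: "(nat \<Rightarrow> 'v) \<Rightarrow> nat \<Rightarrow> 'c \<Rightarrow> nat ugraph" where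
  "layer e n p = \<lparr>verts = {..<n}, edges = {{u, v} | u v. u < v \<and> v < n \<and> joined e p u v}\<rparr>"

definition colour_class :: "(nat \<Rightarrow> 'v) \<Rightarrow> nat \<Rightarrow> 'c \<Rightarrow> nat set" where
  "colour_class e n p = {v. v < n \<and> \<phi> (point e v) = p}"

text \<open>
  The set \<open>l\<close> placed in copy \<open>b\<close>, enlarged by the vertices of colour \<open>p\<close> in earlier copies, all of which
  are joined to it in colour \<open>p\<close>.
\<close>

definition block_clique :: "(nat \<Rightarrow> 'v) \<Rightarrow> nat \<Rightarrow> 'c \<Rightarrow> nat \<Rightarrow> 'v set \<Rightarrow> nat set" where
  "block_clique e n p b l =
     {v. v < n \<and> (copy v = b \<and> point e v \<in> l \<or> copy v < b \<and> \<phi> (point e v) = p)}"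

lemma card_V_pos: "card V > 0"
  using finite_V V_nonempty by (simp add: card_gt_0_iff)

lemma copy_mono: "u \<le> v \<Longrightarrow> copy u \<le> copy v"
  by (simp add: copy_def div_le_mono)

lemma verts_layer [simp]: "verts (layer e n p) = {..<n}"
  by (simp add: layer_def)

lemma edge_layer_iff:
  assumes "u < v"
  shows "{u, v} \<in> edges (layer e n p) \<longleftrightarrow> v < n \<and> joined e p u v"
  using assms by (auto simp: layer_def doubleton_eq_iff)

lemma point_in:
  assumes "bij_betw e {..<card V} V"
  shows "point e v \<in> V"
  using assms card_V_pos unfolding point_def bij_betw_def by auto

lemma point_inj:
  assumes "bij_betw e {..<card V} V" "copy u = copy v" "point e u = point e v"
  shows "u = v"
proof -
  have "u mod card V = v mod card V"
    using assms(1,3) card_V_pos unfolding point_def bij_betw_def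
    by (metis inj_onD lessThan_iff mod_less_divisor)
  then show ?thesis
    using assms(2) unfolding copy_def by (metis div_mult_mod_eq)
qed

lemma unique_layer:
  assumes e: "bij_betw e {..<card V} V" and "u < v"
  shows "\<exists>!p. p \<in> R \<and> joined e p u v"
proof (cases "copy u = copy v")
  case True
  then have "point e u \<noteq> point e v"
    using point_inj[OF e] \<open>u < v\<close> by blast
  from unique_colour[OF point_in[OF e] point_in[OF e] this] show ?thesis
    using True by (simp add: joined_def)
next
  case False
  then show ?thesis
    using colour_in[OF point_in[OF e, of u]] by (auto simp: joined_def)
qed

lemma clique_layerI:
  assumes "S \<subseteq> {..<n}" "\<And>u v. u \<in> S \<Longrightarrow> v \<in> S \<Longrightarrow> u < v \<Longrightarrow> joined e p u v"
  shows "clique (layer e n p) S"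
  unfolding clique_def
proof (intro conjI ballI impI)
  fix u v assume uv: "u \<in> S" "v \<in> S" "u \<noteq> v"
  then consider "u < v" | "v < u" by linarith
  then show "{u, v} \<in> edges (layer e n p)"
  proof cases
    case 1
    then show ?thesis using uv assms edge_layer_iff by auto
  next
    case 2
    then have "{v, u} \<in> edges (layer e n p)" using uv assms edge_layer_iff by auto
    then show ?thesis by (simp add: insert_commute)
  qed
qed (use assms(1) in simp)

lemma clique_layerD:
  assumes "clique (layer e n p) S" "u \<in> S" "v \<in> S" "u < v"
  shows "joined e p u v"
proof -
  have "{u, v} \<in> edges (layer e n p)"
    using assms(1)[unfolded clique_def] assms(2,3) less_imp_neq[OF assms(4)] by simp
  then show ?thesis using edge_layer_iff[OF \<open>u < v\<close>] by blast
qed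

lemma clique_colour_class: "clique (layer e n p) (colour_class e n p)"
  by (rule clique_layerI) (auto simp: colour_class_def joined_def)

lemma clique_block_clique:
  assumes "l \<in> F p"
  shows "clique (layer e n p) (block_clique e n p b l)"
proof (rule clique_layerI)
  fix u v
  assume uv: "u \<in> block_clique e n p b l" "v \<in> block_clique e n p b l" "u < v"
  have le: "copy u \<le> copy v" using uv(3) by (simp add: copy_mono)
  have mem: "copy w = b \<and> point e w \<in> l \<or> copy w < b \<and> \<phi> (point e w) = p"
    if "w \<in> block_clique e n p b l" for w
    using that by (simp add: block_clique_def)
  show "joined e p u v"
  proof (cases "copy u = copy v")
    case True
    then show ?thesis using mem[OF uv(1)] mem[OF uv(2)] assms by (auto simp: joined_def)
  next
    case False
    then have "copy u < b" using le mem[OF uv(2)] by linarith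
    then show ?thesis using False mem[OF uv(1)] by (simp add: joined_def)
  qed
qed (auto simp: block_clique_def)

text \<open>
  In the graph of colour \<open>p\<close> a vertex \<open>x\<close> of another colour has no neighbour in a later copy (those
  edges have the colour of \<open>x\<close>), and in its own copy it is joined only to the rest of its unique block.
  Hence a single such vertex confines a clique to its block and to the vertices of colour \<open>p\<close> in
  earlier copies.
\<close>

lemma clique_subset:
  assumes e: "bij_betw e {..<card V} V" and p: "p \<in> R" and S: "clique (layer e n p) S"
  shows "S \<subseteq> colour_class e n p \<or> (\<exists>b \<le> n div card V. \<exists>l\<in>F p. S \<subseteq> block_clique e n p b l)"
proof (cases "S \<subseteq> colour_class e n p")
  case False
  have Sn: "S \<subseteq> {..<n}" using S by (simp add: clique_def)
  obtain x where x: "x \<in> S" "\<phi> (point e x) \<noteq> p"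
    using False Sn by (auto simp: colour_class_def)
  obtain l where l: "l \<in> F p" "point e x \<in> l"
    and l_unique: "\<And>m. m \<in> F p \<Longrightarrow> point e x \<in> m \<Longrightarrow> m = l"
    using unique_block[OF p point_in[OF e] x(2)] by blast
  have "S \<subseteq> block_clique e n p (copy x) l"
  proof
    fix y assume y: "y \<in> S"
    consider "y = x" | "x < y" | "y < x" by linarith
    then show "y \<in> block_clique e n p (copy x) l"
    proof cases
      case 1
      then show ?thesis using l x Sn by (auto simp: block_clique_def)
    next
      case 2
      then have "joined e p x y" using clique_layerD[OF S] x y by blast
      then show ?thesis
        using x y Sn l_unique by (auto simp: block_clique_def joined_def split: if_splits)
    next
      case 3
      then have "joined e p y x" "copy y \<le> copy x"
        using clique_layerD[OF S] x y by (auto intro: copy_mono)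
      then show ?thesis
        using x y Sn l_unique by (auto simp: block_clique_def joined_def split: if_splits)
    qed
  qed
  moreover have "copy x \<le> n div card V"
    using x Sn by (auto simp: copy_def intro!: div_le_mono)
  ultimately show ?thesis using l by blast
qed simp

text \<open>
  The sets of \<open>clique_subset\<close> are themselves cliques, so every maximal clique is one of them.
\<close>

lemma num_maximal_cliques_layer:
  assumes e: "bij_betw e {..<card V} V" and p: "p \<in> R"
  shows "num_maximal_cliques (layer e n p) \<le> 1 + (n div card V + 1) * card (F p)"
proof -
  let ?B = "(\<lambda>(b, l). block_clique e n p b l) ` ({..n div card V} \<times> F p)"
  have "{S. maximal_clique (layer e n p) S} \<subseteq> insert (colour_class e n p) ?B"
  proof
    fix S assume "S \<in> {S. maximal_clique (layer e n p) S}"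
    then have S: "clique (layer e n p) S"
      and max: "\<And>T. clique (layer e n p) T \<Longrightarrow> S \<subseteq> T \<Longrightarrow> T = S"
      by (auto simp: maximal_clique_def)
    from clique_subset[OF e p S] show "S \<in> insert (colour_class e n p) ?B"
      using max[OF clique_colour_class] max[OF clique_block_clique] by force
  qed
  then have "num_maximal_cliques (layer e n p) \<le> card (insert (colour_class e n p) ?B)"
    unfolding num_maximal_cliques_def using finite_F[OF p] by (intro card_mono) auto
  also have "\<dots> \<le> 1 + card ?B"
    by (simp add: card_insert_if finite_F[OF p])
  also have "card ?B \<le> (n div card V + 1) * card (F p)"
    using card_image_le[of "{..n div card V} \<times> F p" "\<lambda>(b, l). block_clique e n p b l"]
      finite_F[OF p] by (simp add: card_cartesian_product)
  finally show ?thesis by simp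
qed

lemma layers_factorization:
  assumes e: "bij_betw e {..<card V} V" and c: "bij_betw c {1..t} R" and "n \<ge> 1"
  shows "factorization (complete_graph n) t (\<lambda>i. layer e n (c i))"
proof -
  have simple: "simple_graph (layer e n p)" for p
    unfolding simple_graph_def
  proof (intro conjI ballI)
    show "verts (layer e n p) \<noteq> {}"
      using \<open>n \<ge> 1\<close> by (simp add: lessThan_empty_iff)
    fix d assume "d \<in> edges (layer e n p)"
    then obtain u v where "d = {u, v}" "u < v" "v < n" by (auto simp: layer_def)
    then show "d \<subseteq> verts (layer e n p)" "card d = 2" by auto
  qed simp
  have disj: "disjoint_family_on (\<lambda>i. edges (layer e n (c i))) {1..t}"
    unfolding disjoint_family_on_def
  proof (intro ballI impI)
    fix i j assume ij: "i \<in> {1..t}" "j \<in> {1..t}" "i \<noteq> j"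
    have cij: "c i \<in> R" "c j \<in> R" "c i \<noteq> c j"
      using bij_betwE[OF c] inj_onD[OF bij_betw_imp_inj_on[OF c] _ ij(1,2)] ij by blast+
    show "edges (layer e n (c i)) \<inter> edges (layer e n (c j)) = {}"
    proof (rule ccontr)
      assume "\<not> ?thesis"
      then obtain d where d: "d \<in> edges (layer e n (c i))" "d \<in> edges (layer e n (c j))"
        by blast
      from d(1) obtain u v where uv: "d = {u, v}" "u < v" "joined e (c i) u v"
        by (auto simp: layer_def)
      then have "joined e (c j) u v" using d(2) edge_layer_iff[OF uv(2)] by blast
      then show False
        using unique_layer[OF e uv(2)] cij uv(3) by blast
    qed
  qed
  have "(\<Union>i\<in>{1..t}. edges (layer e n (c i))) = edges (complete_graph n)"
  proof
    show "(\<Union>i\<in>{1..t}. edges (layer e n (c i))) \<subseteq> edges (complete_graph n)"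
      by (auto simp: layer_def complete_graph_def)
    show "edges (complete_graph n) \<subseteq> (\<Union>i\<in>{1..t}. edges (layer e n (c i)))"
    proof
      fix d assume "d \<in> edges (complete_graph n)"
      then have d: "d \<subseteq> {..<n}" "card d = 2" by (auto simp: complete_graph_def)
      obtain u v where uv: "d = {u, v}" "u < v"
        using d(2) unfolding card_2_iff by (metis insert_commute linorder_neqE_nat)
      obtain p where "p \<in> R" "joined e p u v" using unique_layer[OF e \<open>u < v\<close>] by blast
      moreover obtain i where "i \<in> {1..t}" "c i = p"
        using c \<open>p \<in> R\<close> unfolding bij_betw_def by blast
      ultimately show "d \<in> (\<Union>i\<in>{1..t}. edges (layer e n (c i)))"
        using uv d edge_layer_iff[OF \<open>u < v\<close>] by auto
    qed
  qed
  then show ?thesis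
    using simple disj by (simp add: factorization_def complete_graph_def)
qed

text \<open>
  There are \<open>n div card V + 1\<close> copies, the last one possibly incomplete.  The extra copy accounts for
  the \<open>card V\<close> in the constant, and the large cliques, one for each colour, for the \<open>card R\<close>.
\<close>

lemma f2_le_linear:
  assumes "finite R" "n \<ge> 1"
  shows "f2 (card R) n \<le> n + (card V + card R)"
proof -
  obtain e where e: "bij_betw e {..<card V} V"
    using ex_bij_betw_nat_finite[OF finite_V] by (auto simp: atLeast0LessThan)
  obtain c where c: "bij_betw c {1..card R} R"
    using ex_bij_betw_nat_finite_1[OF assms(1)] by blast
  let ?k = "n div card V"
  have "f2 (card R) n \<le> (\<Sum>i\<in>{1..card R}. num_maximal_cliques (layer e n (c i)))"
    by (rule f2_le[OF layers_factorization[OF e c assms(2)]])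
  also have "\<dots> = (\<Sum>p\<in>R. num_maximal_cliques (layer e n p))"
    by (rule sum.reindex_bij_betw[OF c])
  also have "\<dots> \<le> (\<Sum>p\<in>R. 1 + (?k + 1) * card (F p))"
    by (rule sum_mono) (rule num_maximal_cliques_layer[OF e])
  also have "\<dots> = card R + (?k + 1) * (\<Sum>p\<in>R. card (F p))"
    unfolding sum.distrib sum_distrib_left[symmetric] by simp
  also have "\<dots> \<le> card R + (?k + 1) * card V"
    using few_blocks by (intro add_left_mono mult_left_mono) auto
  also have "\<dots> = ?k * card V + (card V + card R)"
    by (simp add: algebra_simps)
  also have "\<dots> \<le> n + (card V + card R)"
    by simp
  finally show ?thesis .
qed

end


section \<open>Patterns from projective planes\<close>

definition line_through :: "'p set set \<Rightarrow> 'p \<Rightarrow> 'p \<Rightarrow> 'p set" where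
  "line_through L x y = (THE l. l \<in> L \<and> x \<in> l \<and> y \<in> l)"

locale plane =
  fixes q :: nat and P :: "'p set" and L :: "'p set set"
  assumes plane: "projective_plane q P L"
begin

lemma order_ge: "q \<ge> 2"
  and finite_P: "finite P"
  and lines_subset: "\<forall>l\<in>L. l \<subseteq> P"
  and ex1_line: "\<forall>x\<in>P. \<forall>y\<in>P. x \<noteq> y \<longrightarrow> (\<exists>!l. l \<in> L \<and> x \<in> l \<and> y \<in> l)"
  and ex1_point: "\<forall>l\<in>L. \<forall>m\<in>L. l \<noteq> m \<longrightarrow> (\<exists>!x. x \<in> l \<and> x \<in> m)"
  and four_points: "\<exists>Q\<subseteq>P. card Q = 4 \<and> (\<forall>l\<in>L. card (Q \<inter> l) \<le> 2)"
  and card_lines: "\<forall>l\<in>L. card l = q + 1"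
  using plane unfolding projective_plane_def by - (elim conjE, assumption)+

lemma line_subset: "l \<in> L \<Longrightarrow> l \<subseteq> P"
  using lines_subset by (rule bspec)

lemma card_line: "l \<in> L \<Longrightarrow> card l = q + 1"
  using card_lines by (rule bspec)

lemma finite_L: "finite L"
proof (rule finite_subset)
  show "L \<subseteq> Pow P" using line_subset by blast
qed (simp add: finite_P)

lemma finite_line: "l \<in> L \<Longrightarrow> finite l"
  using finite_P line_subset finite_subset by blast

lemma line_unique:
  "x \<noteq> y \<Longrightarrow> l \<in> L \<Longrightarrow> m \<in> L \<Longrightarrow> x \<in> l \<Longrightarrow> y \<in> l \<Longrightarrow> x \<in> m \<Longrightarrow> y \<in> m \<Longrightarrow> l = m"
  using ex1_point[rule_format, of l m] by blast

lemma line_through: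
  assumes "x \<in> P" "y \<in> P" "x \<noteq> y"
  shows "line_through L x y \<in> L" "x \<in> line_through L x y" "y \<in> line_through L x y"
proof -
  from theI'[OF ex1_line[rule_format, OF assms]] show "line_through L x y \<in> L" "x \<in> line_through L x y" "y \<in> line_through L x y"
    unfolding line_through_def by auto
qed

lemma line_through_eq:
  assumes "x \<noteq> y" "l \<in> L" "x \<in> l" "y \<in> l"
  shows "line_through L x y = l"
proof -
  have "x \<in> P" "y \<in> P" using line_subset[OF assms(2)] assms(3,4) by blast+
  note m = line_through[OF this assms(1)]
  show ?thesis
    by (rule line_unique[OF assms(1) m(1) assms(2) m(2,3) assms(3,4)])
qed

lemma lines_meet:
  assumes "l \<in> L" "m \<in> L" "l \<noteq> m"
  obtains x where "x \<in> l" "x \<in> m"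
  using ex1_point[rule_format, OF assms] by blast

text \<open>
  The line through two points of a quadrangle misses the other two.  One of the two points off the
  line can play the part of \<open>a\<close>, and the other one then witnesses that the pattern is nonempty.
\<close>

lemma line_and_two_points:
  obtains l y z where "l \<in> L" "y \<in> P - l" "z \<in> P - l" "y \<noteq> z"
proof -
  obtain Q where Q: "Q \<subseteq> P" "card Q = 4" "\<And>l. l \<in> L \<Longrightarrow> card (Q \<inter> l) \<le> 2"
    using four_points by auto
  have finQ: "finite Q" by (rule finite_subset[OF Q(1) finite_P])
  have "\<exists>a\<in>Q. \<exists>b\<in>Q. a \<noteq> b"
  proof (rule ccontr)
    assume "\<not> ?thesis"
    then have "card Q \<le> Suc 0" using card_le_Suc0_iff_eq[OF finQ] by blast
    then show False using Q(2) by simp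
  qed
  then obtain a b where ab: "a \<in> Q" "b \<in> Q" "a \<noteq> b" by blast
  define l where "l = line_through L a b"
  have l: "l \<in> L" unfolding l_def
    by (rule line_through(1)) (use ab Q(1) in auto)
  have "card (Q - l) \<ge> 2"
    using Q(2) Q(3)[OF l] card_Diff_subset_Int[of Q l] finQ by simp
  then have "\<not> card (Q - l) \<le> Suc 0" by simp
  then obtain y z where "y \<in> Q - l" "z \<in> Q - l" "y \<noteq> z"
    using card_le_Suc0_iff_eq[of "Q - l"] finQ by blast
  then show ?thesis using that[of l y z] l Q(1) by blast
qed

text \<open>
  Every line through \<open>a\<close> meets \<open>m\<close>, and joining \<open>a\<close> to that point of \<open>m\<close> gives the line back.
\<close>

lemma card_pencil:
  assumes a: "a \<in> P" and m: "m \<in> L" "a \<notin> m"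
  shows "card {l \<in> L. a \<in> l} \<le> q + 1"
proof -
  have "{l \<in> L. a \<in> l} \<subseteq> line_through L a ` m"
  proof
    fix l assume l: "l \<in> {l \<in> L. a \<in> l}"
    then obtain x where x: "x \<in> l" "x \<in> m" using lines_meet[of l m] m by blast
    then have "line_through L a x = l" using l m by (intro line_through_eq) auto
    then show "l \<in> line_through L a ` m" using x by blast
  qed
  then have "card {l \<in> L. a \<in> l} \<le> card m"
    using surj_card_le[OF finite_line[OF m(1)]] by blast
  then show ?thesis using card_line[OF m(1)] by simp
qed

text \<open>
  The lines through \<open>a\<close> are labelled by colours through an injection \<open>\<gamma>\<close>, and a point gets the label of
  the line joining it to \<open>a\<close>.  If \<open>a\<close> is off \<open>L0\<close>, the line through \<open>a\<close> and a colour \<open>p\<close> is not among the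
  blocks of \<open>p\<close>, so its points lie in no block of \<open>p\<close> and must have colour \<open>p\<close>; this is why \<open>\<gamma>\<close>
  then has to label a line by its own point on \<open>L0\<close>.  If \<open>a\<close> is on \<open>L0\<close>, the lines other than \<open>L0\<close>
  through a colour all avoid \<open>a\<close>, so its blocks cover all of \<open>V\<close> and any injection will do.

  The blocks are counted by the pairs \<open>(p, x)\<close> for which \<open>x\<close> lies in a block of \<open>p\<close>: each block
  contributes \<open>q\<close> pairs, and each point \<open>x\<close> takes part in at most \<open>q\<close> of them.  The latter holds because there
  are only \<open>q\<close> colours if \<open>a\<close> is on \<open>L0\<close>, and because the colour of \<open>x\<close> itself is excluded among the
  \<open>q + 1\<close> colours if \<open>a\<close> is off \<open>L0\<close>.
\<close>

lemma plane_pattern: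
  assumes L0: "L0 \<in> L" and a: "a \<in> P"
    and nonempty: "P - insert a L0 \<noteq> {}"
    and \<gamma>: "inj_on \<gamma> {l \<in> L. a \<in> l \<and> l \<noteq> L0}"
      "\<And>l. l \<in> L \<Longrightarrow> a \<in> l \<Longrightarrow> l \<noteq> L0 \<Longrightarrow> \<gamma> l \<in> L0 - {a}"
      "\<And>l. l \<in> L \<Longrightarrow> a \<in> l \<Longrightarrow> a \<notin> L0 \<Longrightarrow> \<gamma> l \<in> l"
  shows "pattern (P - insert a L0) (L0 - {a}) (\<lambda>x. \<gamma> (line_through L a x))
           (\<lambda>p. {l \<in> L. p \<in> l \<and> l \<noteq> L0 \<and> a \<notin> l})"
proof -
  define V where "V = P - insert a L0"
  define R where "R = L0 - {a}"
  define \<phi> where "\<phi> = (\<lambda>x. \<gamma> (line_through L a x))"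
  define F where "F = (\<lambda>p. {l \<in> L. p \<in> l \<and> l \<noteq> L0 \<and> a \<notin> l})"
  have fin: "finite V" "finite R"
    unfolding V_def R_def using finite_P finite_line[OF L0] by auto
  have spoke: "line_through L a x \<in> L" "a \<in> line_through L a x" "x \<in> line_through L a x"
    "line_through L a x \<noteq> L0" if "x \<in> V" for x
    using that a line_through[of a x] unfolding V_def by auto
  have \<phi>_in: "\<phi> x \<in> R" if "x \<in> V" for x
    unfolding \<phi>_def R_def using spoke[OF that] by (intro \<gamma>(2))
  have \<phi>_eqI: "\<phi> x = \<gamma> l" if "x \<in> V" "l \<in> L" "a \<in> l" "x \<in> l" for x l
    using that line_through_eq[of a x l] unfolding \<phi>_def V_def by auto
  \<comment> \<open>The line through \<open>a\<close> and \<open>x\<close> passes through the colour of \<open>x\<close>, so no block of that colour contains \<open>x\<close>.\<close>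
  have avoid: "x \<in> V \<Longrightarrow> l \<in> F p \<Longrightarrow> x \<in> l \<Longrightarrow> a \<notin> L0 \<Longrightarrow> p \<in> R \<Longrightarrow> \<phi> x \<noteq> p" for x l p
  proof
    assume *: "x \<in> V" "l \<in> F p" "x \<in> l" "a \<notin> L0" "p \<in> R" "\<phi> x = p"
    then have "p \<in> line_through L a x" unfolding \<phi>_def using \<gamma>(3) spoke by blast
    moreover have "p \<noteq> x" using * unfolding V_def R_def by blast
    ultimately have "line_through L a x = l"
      using * spoke[of x] line_unique[of p x "line_through L a x" l] unfolding F_def by blast
    then show False using * spoke[of x] unfolding F_def by blast
  qed
  have block: "\<exists>!l. l \<in> F p \<and> x \<in> l" if p: "p \<in> R" and x: "x \<in> V" and ne: "\<phi> x \<noteq> p" for p x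
  proof -
    have px: "p \<in> P" "x \<in> P" "p \<noteq> x" using p x line_subset[OF L0] unfolding R_def V_def by auto
    note l = line_through[OF px]
    have "line_through L p x \<noteq> L0" using l x unfolding V_def by blast
    moreover have "a \<notin> line_through L p x"
    proof
      assume al: "a \<in> line_through L p x"
      show False
      proof (cases "a \<in> L0")
        case True
        then show False
          using al l p L0 line_unique[of a p "line_through L p x" L0] \<open>line_through L p x \<noteq> L0\<close> unfolding R_def by blast
      next
        case False
        define m where "m = line_through L p x"
        have m: "m \<in> L" "a \<in> m" "p \<in> m" "m \<noteq> L0"
          using al l \<open>line_through L p x \<noteq> L0\<close> unfolding m_def by auto
        have "\<gamma> m \<in> m" "\<gamma> m \<in> L0" using \<gamma>(2,3) m False by auto
        then have "\<gamma> m = p" using line_unique[of "\<gamma> m" p m L0] m p L0 unfolding R_def by blast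
        then show False using ne \<phi>_eqI[OF x m(1,2)] l unfolding m_def by simp
      qed
    qed
    ultimately have "line_through L p x \<in> F p" using l unfolding F_def by simp
    moreover have "l' = line_through L p x" if "l' \<in> F p" "x \<in> l'" for l'
      using that l line_unique[OF px(3), of l' "line_through L p x"] unfolding F_def by blast
    ultimately show ?thesis using l by blast
  qed
  have colour: "\<exists>!p. p \<in> R \<and> (\<phi> x = p \<and> \<phi> y = p \<or> (\<exists>l\<in>F p. x \<in> l \<and> y \<in> l))"
    if x: "x \<in> V" and y: "y \<in> V" and "x \<noteq> y" for x y
  proof -
    define l where "l = line_through L x y"
    have l: "l \<in> L" "x \<in> l" "y \<in> l"
      unfolding l_def using line_through[of x y] x y \<open>x \<noteq> y\<close> by (auto simp: V_def)
    have lL0: "l \<noteq> L0" using l x unfolding V_def by blast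
    have l_unique: "m = l" if "m \<in> L" "x \<in> m" "y \<in> m" for m
      by (rule line_unique[OF \<open>x \<noteq> y\<close> that(1) l(1) that(2,3) l(2,3)])
    show ?thesis
    proof (cases "a \<in> l")
      case True
      have "\<phi> x = \<gamma> l" "\<phi> y = \<gamma> l" using \<phi>_eqI l True x y by auto
      then show ?thesis
        using \<phi>_in[OF x] l_unique True by (intro ex1I[of _ "\<gamma> l"]) (auto simp: F_def)
    next
      case False
      obtain p where p: "p \<in> l" "p \<in> L0" using lines_meet[OF l(1) L0 lL0] .
      have pR: "p \<in> R" using p False unfolding R_def by blast
      have lF: "l \<in> F p" using l p lL0 False unfolding F_def by blast
      show ?thesis
      proof (intro ex1I[of _ p] conjI)
        show "\<phi> x = p \<and> \<phi> y = p \<or> (\<exists>l\<in>F p. x \<in> l \<and> y \<in> l)" using lF l by blast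
      next
        fix r assume r: "r \<in> R \<and> (\<phi> x = r \<and> \<phi> y = r \<or> (\<exists>l\<in>F r. x \<in> l \<and> y \<in> l))"
        have "\<not> (\<phi> x = r \<and> \<phi> y = r)"
        proof
          assume "\<phi> x = r \<and> \<phi> y = r"
          then have "line_through L a x = line_through L a y"
            using \<gamma>(1) spoke[OF x] spoke[OF y] unfolding \<phi>_def inj_on_def by blast
          then have "line_through L a x = l" using l_unique spoke[OF x] spoke[OF y] by metis
          then show False using False spoke[OF x] by blast
        qed
        then have "l \<in> F r" using r l_unique unfolding F_def by blast
        then show "r = p"
          using r p l lL0 L0 line_unique[of r p l L0] unfolding F_def R_def by blast
      qed (rule pR)
    qed
  qed
  have finF: "finite (F p)" for p unfolding F_def using finite_L by simp
  have count: "q * card (F p) = card (\<Union>l\<in>F p. l - {p})" if "p \<in> R" for p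
  proof -
    have "card (\<Union>l\<in>F p. l - {p}) = (\<Sum>l\<in>F p. card (l - {p}))"
    proof (rule card_UN_disjoint[OF finF])
      show "\<forall>l\<in>F p. finite (l - {p})" unfolding F_def using finite_line by simp
      show "\<forall>l\<in>F p. \<forall>m\<in>F p. l \<noteq> m \<longrightarrow> (l - {p}) \<inter> (m - {p}) = {}"
      proof (intro ballI impI)
        fix l m assume "l \<in> F p" "m \<in> F p" "l \<noteq> m"
        then show "(l - {p}) \<inter> (m - {p}) = {}"
          using ex1_point[rule_format, of l m] unfolding F_def by blast
      qed
    qed
    also have "\<dots> = (\<Sum>l\<in>F p. q)"
      by (rule sum.cong) (auto simp: F_def card_line)
    finally show ?thesis by simp
  qed
  have sub: "(\<Union>l\<in>F p. l - {p}) \<subseteq> V" if "p \<in> R" for p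
  proof
    fix x assume "x \<in> (\<Union>l\<in>F p. l - {p})"
    then obtain l where l: "l \<in> L" "p \<in> l" "l \<noteq> L0" "a \<notin> l" "x \<in> l" "x \<noteq> p"
      unfolding F_def by blast
    have "x \<notin> L0" using line_unique[of x p l L0] l L0 that unfolding R_def by blast
    then show "x \<in> V" using l line_subset unfolding V_def by blast
  qed
  have "(\<Sum>p\<in>R. card (F p)) \<le> card V"
  proof -
    have "q * (\<Sum>p\<in>R. card (F p)) = (\<Sum>p\<in>R. card (\<Union>l\<in>F p. l - {p}))"
      unfolding sum_distrib_left by (rule sum.cong) (simp_all add: count)
    also have "\<dots> \<le> q * card V"
    proof (cases "a \<in> L0")
      case True
      then have "card R = q" unfolding R_def using card_line[OF L0] finite_line[OF L0] by simp
      moreover have "(\<Sum>p\<in>R. card (\<Union>l\<in>F p. l - {p})) \<le> (\<Sum>p\<in>R. card V)"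
        by (rule sum_mono) (rule card_mono[OF fin(1) sub])
      ultimately show ?thesis by simp
    next
      case False
      then have cR: "card R = q + 1" unfolding R_def using card_line[OF L0] by simp
      have "(\<Sum>p\<in>R. card (\<Union>l\<in>F p. l - {p})) \<le> (\<Sum>p\<in>R. card {x \<in> V. \<phi> x \<noteq> p})"
      proof (intro sum_mono card_mono)
        fix p assume "p \<in> R"
        then show "(\<Union>l\<in>F p. l - {p}) \<subseteq> {x \<in> V. \<phi> x \<noteq> p}"
          using sub[of p] avoid[of _ _ p] False by blast
      qed (use fin in simp)
      also have "\<dots> = (\<Sum>p\<in>R. \<Sum>x\<in>V. if \<phi> x \<noteq> p then 1 else 0)"
        using fin by (simp add: sum.inter_filter[symmetric])
      also have "\<dots> = (\<Sum>x\<in>V. \<Sum>p\<in>R. if \<phi> x \<noteq> p then 1 else 0)"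
        by (rule sum.swap)
      also have "\<dots> = (\<Sum>x\<in>V. q)"
      proof (rule sum.cong)
        fix x assume "x \<in> V"
        have "(\<Sum>p\<in>R. if \<phi> x \<noteq> p then 1 else 0) = card {p \<in> R. \<phi> x \<noteq> p}"
          using fin by (simp add: sum.inter_filter[symmetric])
        also have "{p \<in> R. \<phi> x \<noteq> p} = R - {\<phi> x}" by auto
        finally show "(\<Sum>p\<in>R. if \<phi> x \<noteq> p then 1 else 0) = q"
          using cR \<phi>_in[OF \<open>x \<in> V\<close>] by simp
      qed simp
      finally show ?thesis by (simp add: mult.commute)
    qed
    finally show ?thesis using order_ge by simp
  qed
  then have "pattern V R \<phi> F"
    using fin finF \<phi>_in block colour nonempty
    by unfold_locales (auto simp: V_def[symmetric])
  then show ?thesis unfolding V_def R_def \<phi>_def F_def .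
qed

text \<open>
  With \<open>a\<close> on \<open>L0\<close> the labelling only needs at most as many lines as labels, and counting the lines
  through \<open>a\<close> needs a line that misses \<open>a\<close>: the one joining another point of \<open>L0\<close> to a point off \<open>L0\<close>.
\<close>

lemma f2_bound_order:
  "\<exists>C. \<forall>n\<ge>1. f2 q n \<le> n + C"
proof -
  obtain L0 y z where L0: "L0 \<in> L" and y: "y \<in> P - L0" by (rule line_and_two_points)
  have "card L0 > Suc 0" using card_line[OF L0] order_ge by simp
  then obtain a p where ap: "a \<in> L0" "p \<in> L0" "a \<noteq> p"
    using card_le_Suc0_iff_eq[OF finite_line[OF L0]] by (metis linorder_not_le)
  have aP: "a \<in> P" "p \<in> P" using ap L0 line_subset by auto
  have m: "line_through L y p \<in> L" "y \<in> line_through L y p" "p \<in> line_through L y p"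
    using line_through[of y p] y ap aP by auto
  have "a \<notin> line_through L y p"
    using line_unique[of a p "line_through L y p" L0] m ap L0 y by blast
  then have pencil: "card {l \<in> L. a \<in> l} \<le> q + 1" using card_pencil[OF aP(1) m(1)] by blast
  have "{l \<in> L. a \<in> l \<and> l \<noteq> L0} = {l \<in> L. a \<in> l} - {L0}" by auto
  then have "card {l \<in> L. a \<in> l \<and> l \<noteq> L0} \<le> q"
    using pencil L0 ap finite_L by simp
  moreover have cR: "card (L0 - {a}) = q" using card_line[OF L0] ap finite_line[OF L0] by simp
  ultimately obtain \<gamma> where \<gamma>: "inj_on \<gamma> {l \<in> L. a \<in> l \<and> l \<noteq> L0}"
    "\<gamma> ` {l \<in> L. a \<in> l \<and> l \<noteq> L0} \<subseteq> L0 - {a}"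
    using card_le_inj[of "{l \<in> L. a \<in> l \<and> l \<noteq> L0}" "L0 - {a}"] finite_L finite_line[OF L0] by auto
  have "P - insert a L0 \<noteq> {}" using y ap by blast
  then interpret pattern "P - insert a L0" "L0 - {a}" "\<lambda>x. \<gamma> (line_through L a x)"
      "\<lambda>p. {l \<in> L. p \<in> l \<and> l \<noteq> L0 \<and> a \<notin> l}"
    using \<gamma> L0 aP ap by (intro plane_pattern) auto
  have "finite (L0 - {a})" using finite_line[OF L0] by simp
  from f2_le_linear[OF this] show ?thesis unfolding cR by blast
qed

text \<open>
  With \<open>a\<close> off \<open>L0\<close> each line through \<open>a\<close> is labelled by its intersection with \<open>L0\<close>.
\<close>

lemma f2_bound_order_plus_1:
  "\<exists>C. \<forall>n\<ge>1. f2 (q + 1) n \<le> n + C"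
proof -
  obtain L0 a z where L0: "L0 \<in> L" and a: "a \<in> P - L0" and z: "z \<in> P - L0" "a \<noteq> z"
    by (rule line_and_two_points)
  define \<gamma> where "\<gamma> = (\<lambda>l. SOME x. x \<in> l \<and> x \<in> L0)"
  have \<gamma>: "\<gamma> l \<in> l" "\<gamma> l \<in> L0" if "l \<in> L" "a \<in> l" for l
  proof -
    have "\<exists>x. x \<in> l \<and> x \<in> L0" using lines_meet[of l L0] that L0 a by blast
    from someI_ex[OF this] show "\<gamma> l \<in> l" "\<gamma> l \<in> L0" unfolding \<gamma>_def by auto
  qed
  have "inj_on \<gamma> {l \<in> L. a \<in> l \<and> l \<noteq> L0}"
  proof (rule inj_onI)
    fix l m assume *: "l \<in> {l \<in> L. a \<in> l \<and> l \<noteq> L0}" "m \<in> {l \<in> L. a \<in> l \<and> l \<noteq> L0}" "\<gamma> l = \<gamma> m"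
    have "\<gamma> l \<noteq> a" using \<gamma>(2)[of l] * a by auto
    then show "l = m" using line_unique[of "\<gamma> l" a l m] * \<gamma>(1)[of l] \<gamma>(1)[of m] by auto
  qed
  moreover have "P - insert a L0 \<noteq> {}" using z by blast
  ultimately interpret pattern "P - insert a L0" "L0 - {a}" "\<lambda>x. \<gamma> (line_through L a x)"
      "\<lambda>p. {l \<in> L. p \<in> l \<and> l \<noteq> L0 \<and> a \<notin> l}"
    using \<gamma> L0 a by (intro plane_pattern) auto
  have "card (L0 - {a}) = q + 1" "finite (L0 - {a})"
    using card_line[OF L0] finite_line[OF L0] a by simp_all
  with f2_le_linear show ?thesis by metis
qed

end

theorem theorem21:
  fixes t :: nat
  assumes "t \<ge> 2"
    and "(\<exists>(P :: 'p set) L. projective_plane t P L) \<or>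
         (\<exists>(P :: 'q set) L. projective_plane (t - 1) P L)"
  shows "\<exists>C :: nat. \<forall>n\<ge>1. f2 t n \<le> n + C"
  using assms(2)
proof
  assume "\<exists>(P :: 'p set) L. projective_plane t P L"
  then obtain P :: "'p set" and L where "plane t P L" by (auto simp: plane_def)
  then show ?thesis by (rule plane.f2_bound_order)
next
  assume "\<exists>(P :: 'q set) L. projective_plane (t - 1) P L"
  then obtain P :: "'q set" and L where "plane (t - 1) P L" by (auto simp: plane_def)
  from plane.f2_bound_order_plus_1[OF this] show ?thesis
    using assms(1) by simp
qed

end
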